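(* Let $f$ be analytic on $\mathbb{D}$ with $\operatorname{Re} f>0$ on $\mathbb{D}$, $f'(0)=0$, and $f(0)$ a positive real number. Then there exists a positive Borel measure $\nu$ on $\widehat{\Theta}$ (of total mass $f(0)$) such that $$f(z)=\int_{\widehat{\Theta}} h_\vartheta(z)\,d\nu(\vartheta)\qquad(z\in\mathbb{D}).$$
   Context: $\widehat{\Theta}$ is the set of probability measures on the unit circle $\mathbb{T}$ of the following two kinds: (i) $\frac12(\delta_a+\delta_{-a})$ with $a\in\mathbb{T}$; (ii) $\lambda_1\delta_{w_1}+\lambda_2\delta_{w_2}+\lambda_3\delta_{w_3}$ with $w_1,w_2,w_3\in\mathbb{T}$ distinct, $0$ in the interior of the triangle with vertices $w_1,w_2,w_3$, and $(\lambda_1,\lambda_2,\lambda_3)$ the barycentric coordinates of $0$ with respect to these vertices. $\widehat{\Theta}$ carries the weak-* topology (as a subset of the dual of $C_{\mathbb{R}}(\mathbb{T})$). For $\vartheta\in\widehat\Theta$, $h_\vartheta(z)=\int_{\mathbb{T}}\frac{w+z}{w-z}\,d\vartheta(w)$. *)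

theory Defs
  imports "HOL-Analysis.Analysis"
begin

text \<open>A finitely supported probability measure on the unit circle is represented by its
  weight function p; the measure is the sum over w with p w \<noteq> 0 of p w times the Dirac mass at w.\<close>

type_synonym circ_meas = "complex \<Rightarrow> real"

definition supp_w :: "circ_meas \<Rightarrow> complex set" where
  "supp_w p = {w. p w \<noteq> 0}"

definition pair_w :: "circ_meas \<Rightarrow> (complex \<Rightarrow> 'b::real_vector) \<Rightarrow> 'b" where
  "pair_w p g = (\<Sum>w\<in>supp_w p. p w *\<^sub>R g w)"

definition unit_circle :: "complex set" where
  "unit_circle = sphere 0 1"

definition two_point :: "complex \<Rightarrow> circ_meas" where
  "two_point a = (\<lambda>w. if w = a \<or> w = - a then 1/2 else 0)"

definition three_point ::
  "complex \<Rightarrow> complex \<Rightarrow> complex \<Rightarrow> real \<Rightarrow> real \<Rightarrow> real \<Rightarrow> circ_meas" where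
  "three_point w1 w2 w3 l1 l2 l3 =
     (\<lambda>w. if w = w1 then l1 else if w = w2 then l2 else if w = w3 then l3 else 0)"

definition ThetaHat :: "circ_meas set" where
  "ThetaHat =
     {two_point a | a. a \<in> unit_circle}
   \<union> {three_point w1 w2 w3 l1 l2 l3 | w1 w2 w3 l1 l2 l3.
        w1 \<in> unit_circle \<and> w2 \<in> unit_circle \<and> w3 \<in> unit_circle \<and>
        w1 \<noteq> w2 \<and> w1 \<noteq> w3 \<and> w2 \<noteq> w3 \<and>
        0 \<in> interior (convex hull {w1, w2, w3}) \<and>
        l1 + l2 + l3 = 1 \<and>
        of_real l1 * w1 + of_real l2 * w2 + of_real l3 * w3 = 0}"

definition weakstar_top :: "circ_meas topology" where
  "weakstar_top = topology_generated_by
     {{p \<in> ThetaHat. pair_w p g \<in> U} | g U.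
        continuous_on unit_circle (g :: complex \<Rightarrow> real) \<and> open U}"

definition borel_sets_of :: "'a topology \<Rightarrow> 'a set set" where
  "borel_sets_of T = sigma_sets (topspace T) {U. openin T U}"

definition h_theta :: "circ_meas \<Rightarrow> complex \<Rightarrow> complex" where
  "h_theta p z = pair_w p (\<lambda>w. (w + z) / (w - z))"

end

theory Submission
  imports Defs "HOL-Complex_Analysis.Complex_Analysis" "HOL-Probability.Probability"
begin

text \<open>
  By Herglotz, \<open>f\<close> is the integral of \<open>(w + z) / (w - z)\<close> against \<open>f 0\<close> times a probability
  measure \<open>\<mu>\<close> on the circle, and \<open>f' 0 = 0\<close> says that \<open>\<mu>\<close> has barycentre \<open>0\<close>. Such a \<open>\<mu>\<close> is
  decomposed explicitly, without Choquet theory: pick three independent points \<open>a, x, y\<close> with law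
  \<open>\<mu>\<close>, keep the positively oriented triangles that contain \<open>0\<close>, and weight the measure
  \<open>[x,y] \<delta>\<^sub>a + [y,a] \<delta>\<^sub>x + [a,x] \<delta>\<^sub>y\<close>, where \<open>[x,y]\<close> is the determinant; after normalisation it is
  an element of \<open>ThetaHat\<close>. The mass that the mixture puts on \<open>a\<close>, relative to \<open>\<mu>\<close>, is three times
  the integral of \<open>[x,y]\<close> over the arcs from \<open>x\<close> to \<open>y\<close> that cross the ray through \<open>-a\<close>. It does
  not depend on \<open>a\<close>: the signed numbers of crossings of two rays differ by \<open>k y - k x\<close> with \<open>k\<close> the
  indicator of a sector, and \<open>k y [x,y]\<close> integrates to \<open>0\<close> because \<open>\<mu>\<close> is centred. So the mixture
  is a multiple of \<open>\<mu>\<close>. If the multiple is \<open>0\<close>, then \<open>\<mu>\<close> lives on a line and is itself in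
  \<open>ThetaHat\<close>.
\<close>

section \<open>Herglotz representation\<close>

definition circ :: "real \<Rightarrow> complex" where
  "circ t = cis (2 * pi * t)"

lemma norm_circ [simp]: "norm (circ t) = 1"
  by (simp add: circ_def)

lemma circ_nonzero [simp]: "circ t \<noteq> 0"
  by (simp add: circ_def)

lemma cnj_circ: "cnj (circ t) = 1 / circ t"
  by (simp add: circ_def cis_cnj cis_inverse[symmetric] inverse_eq_divide del: cis_inverse)

lemma continuous_on_circ [continuous_intros]: "continuous_on S circ"
  unfolding circ_def by (intro continuous_intros)

lemma circ_neq: "norm z < 1 \<Longrightarrow> circ t \<noteq> z"
  using norm_circ[of t] by force

text \<open>Cauchy's integral formula on the unit circle: along \<open>circ\<close> one has
  \<open>dw = 2 \<pi> \<i> w dt\<close>, which cancels the prefactor and leaves the extra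
  \<open>circ t\<close> in the numerator.\<close>

lemma Cauchy_has_integral_circ:
  assumes "F holomorphic_on cball 0 1" "norm z < 1"
  shows "((\<lambda>t. F (circ t) * circ t / (circ t - z)) has_integral F z) {0..1}"
proof -
  have "((\<lambda>u. F u / (u - z)) has_contour_integral (2 * of_real pi * \<i> * F z)) (circlepath 0 1)"
    using assms by (intro Cauchy_integral_circlepath_simple) auto
  moreover have "circlepath 0 1 t = circ t" for t
    by (simp add: circlepath circ_def cis_conv_exp mult_ac)
  moreover have "vector_derivative (circlepath 0 1) (at t within {0..1}) = 2 * of_real pi * \<i> * circ t"
    if "t \<in> {0..1}" for t
    using that by (simp add: vector_derivative_circlepath01 circ_def cis_conv_exp mult_ac)
  ultimately have "((\<lambda>t. F (circ t) / (circ t - z) * (2 * of_real pi * \<i> * circ t))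
      has_integral (2 * of_real pi * \<i> * F z)) {0..1}"
    unfolding has_contour_integral_def by (elim has_integral_eq[rotated]) simp
  then have "((\<lambda>t. (1 / (2 * of_real pi * \<i>)) * (F (circ t) / (circ t - z) * (2 * of_real pi * \<i> * circ t)))
      has_integral ((1 / (2 * of_real pi * \<i>)) * (2 * of_real pi * \<i> * F z))) {0..1}"
    by (rule has_integral_mult_right)
  then show ?thesis
    by (simp add: field_simps)
qed

text \<open>Write \<open>Re F\<close> as half of \<open>F + cnj F\<close>. The first half is
  evaluated by Cauchy's formula at \<open>z\<close> and at \<open>0\<close>, the second by
  conjugating a mean value property; the constants cancel because \<open>F 0\<close> is
  real.\<close>

lemma Schwarz_formula:
  assumes F: "F holomorphic_on cball 0 1" and F0: "F 0 \<in> \<real>" and z: "norm z < 1"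
  shows "((\<lambda>t. of_real (Re (F (circ t))) * ((circ t + z) / (circ t - z))) has_integral F z) {0..1}"
proof -
  have ne: "1 - cnj z * w \<noteq> 0" if "norm w \<le> 1" for w
  proof
    assume "1 - cnj z * w = 0"
    then have "cnj z * w = 1" by simp
    from arg_cong[OF this, of norm] have "norm z * norm w = 1"
      by (simp add: norm_mult)
    moreover have "norm z * norm w \<le> norm z"
      using that by (simp add: mult_left_le)
    ultimately show False using z by simp
  qed
  \<comment> \<open>Mean value property for \<open>F\<close> times a factor that is \<open>1\<close>
    at \<open>0\<close> and whose conjugate on the circle is the Herglotz kernel.\<close>
  have "((\<lambda>t. F (circ t) * ((1 + cnj z * circ t) / (1 - cnj z * circ t))) has_integral F 0) {0..1}"
  proof -
    have "(\<lambda>w. F w * ((1 + cnj z * w) / (1 - cnj z * w))) holomorphic_on cball 0 1"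
      using F ne by (intro holomorphic_intros) auto
    from Cauchy_has_integral_circ[OF this, of 0] show ?thesis by simp
  qed
  then have "((\<lambda>t. cnj (F (circ t) * ((1 + cnj z * circ t) / (1 - cnj z * circ t)))) has_integral cnj (F 0)) {0..1}"
    using has_integral_cnj[of "\<lambda>t. F (circ t) * ((1 + cnj z * circ t) / (1 - cnj z * circ t))" "F 0" "{0..1}"]
    unfolding o_def by blast
  moreover have "cnj ((1 + cnj z * circ t) / (1 - cnj z * circ t)) = (circ t + z) / (circ t - z)" for t
  proof -
    show ?thesis
      using circ_neq[OF z, of t] ne[of "circ t"] by (simp add: cnj_circ field_simps)
  qed
  ultimately have A: "((\<lambda>t. cnj (F (circ t)) * ((circ t + z) / (circ t - z))) has_integral F 0) {0..1}"
    using F0 by (simp only: complex_cnj_mult Reals_cnj_iff)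
  \<comment> \<open>From \<open>(w + z) / (w - z) = 2 * w / (w - z) - 1\<close>.\<close>
  have "((\<lambda>t. 2 * (F (circ t) * circ t / (circ t - z)) - F (circ t) * circ t / (circ t - 0)) has_integral 2 * F z - F 0) {0..1}"
    using z F by (intro has_integral_diff has_integral_mult_right Cauchy_has_integral_circ) auto
  then have B: "((\<lambda>t. F (circ t) * ((circ t + z) / (circ t - z))) has_integral 2 * F z - F 0) {0..1}"
    by (rule has_integral_eq[rotated]) (use circ_neq[OF z] in \<open>auto simp: field_simps\<close>)
  have "((\<lambda>t. (1/2) * (F (circ t) * ((circ t + z) / (circ t - z)) + cnj (F (circ t)) * ((circ t + z) / (circ t - z))))
     has_integral (1/2) * (2 * F z - F 0 + F 0)) {0..1}"
    by (intro has_integral_mult_right has_integral_add A B)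
  moreover have "(1/2) * (F (circ t) * K + cnj (F (circ t)) * K) = of_real (Re (F (circ t))) * K" for t K
    by (simp add: complex_add_cnj flip: distrib_right)
  ultimately show ?thesis by (simp only:) simp
qed

text \<open>For \<open>F\<close> holomorphic up to the boundary the measure has the density
  \<open>Re (F (circ t)) / m\<close> on \<open>{0..1}\<close>, and the representation is Schwarz's
  formula. The mass of \<open>{-1<..1}\<close> is recorded because the half-open form fits the
  definition of \<open>tight\<close>; the left end \<open>-1\<close> keeps \<open>0\<close>
  inside.\<close>

lemma Herglotz_approximation:
  assumes F: "F holomorphic_on cball 0 1" and F0: "F 0 = of_real m" and "m > 0"
    and pos: "\<And>z. norm z \<le> 1 \<Longrightarrow> Re (F z) > 0"
  obtains M where "real_distribution M" "measure M {-1<..1} = 1"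
    "\<And>z. norm z < 1 \<Longrightarrow> F z = of_real m * (\<integral>t. (circ t + z) / (circ t - z) \<partial>M)"
proof -
  define p where "p t = indicator {0..1} t * (Re (F (circ t)) / m)" for t
  define M where "M = density lborel (\<lambda>t. ennreal (p t))"
  have contF: "continuous_on S (\<lambda>t. F (circ t))" for S
    by (rule continuous_on_compose2[OF holomorphic_on_imp_continuous_on[OF F] continuous_on_circ]) auto
  have p0: "p t \<ge> 0" for t
    using pos[of "circ t"] \<open>m > 0\<close> by (simp add: p_def indicator_def)
  have [measurable]: "(\<lambda>t. F (circ t)) \<in> borel_measurable borel" "circ \<in> borel_measurable borel"
    using contF continuous_on_circ by (auto intro!: borel_measurable_continuous_onI)
  have pm [measurable]: "p \<in> borel_measurable borel"
    unfolding p_def by measurable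
  have int: "integrable lborel (\<lambda>t. p t *\<^sub>R g t)"
     "(\<integral>t. g t \<partial>M) = integral {0..1} (\<lambda>t. of_real (Re (F (circ t)) / m) * g t)"
     if g: "continuous_on UNIV g" for g :: "real \<Rightarrow> complex"
  proof -
    have [measurable]: "g \<in> borel_measurable borel"
      using g by (rule borel_measurable_continuous_onI)
    have c: "continuous_on {0..1} (\<lambda>t. of_real (Re (F (circ t)) / m) * g t)"
      using \<open>m > 0\<close> by (intro continuous_intros contF continuous_on_subset[OF g]) auto
    have s: "set_integrable lborel {0..1} (\<lambda>t. of_real (Re (F (circ t)) / m) * g t)"
      by (rule borel_integrable_atLeastAtMost'[OF c])
    have eq: "(\<lambda>t. p t *\<^sub>R g t) = (\<lambda>t. indicator {0..1} t *\<^sub>R (of_real (Re (F (circ t)) / m) * g t))"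
      by (auto simp: p_def fun_eq_iff scaleR_conv_of_real indicator_def)
    show "integrable lborel (\<lambda>t. p t *\<^sub>R g t)"
      using s unfolding set_integrable_def eq .
    have "(\<integral>t. g t \<partial>M) = (\<integral>t. p t *\<^sub>R g t \<partial>lborel)"
      unfolding M_def using p0 by (subst integral_density) auto
    also have "\<dots> = integral {0..1} (\<lambda>t. of_real (Re (F (circ t)) / m) * g t)"
      using set_borel_integral_eq_integral(2)[OF s] unfolding set_lebesgue_integral_def eq .
    finally show "(\<integral>t. g t \<partial>M) = integral {0..1} (\<lambda>t. of_real (Re (F (circ t)) / m) * g t)" .
  qed
  have S: "F z = of_real m * (\<integral>t. (circ t + z) / (circ t - z) \<partial>M)" if z: "norm z < 1" for z
  proof -
    have "continuous_on UNIV (\<lambda>t. (circ t + z) / (circ t - z))"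
      using circ_neq[OF z] by (intro continuous_intros) auto
    then have "(\<integral>t. (circ t + z) / (circ t - z) \<partial>M)
       = integral {0..1} (\<lambda>t. of_real (Re (F (circ t)) / m) * ((circ t + z) / (circ t - z)))"
      by (rule int)
    also have "((\<lambda>t. (1 / of_real m) * (of_real (Re (F (circ t))) * ((circ t + z) / (circ t - z)))) has_integral (1 / of_real m) * F z) {0..1}"
      by (intro has_integral_mult_right Schwarz_formula z F) (auto simp: F0)
    then have "integral {0..1} (\<lambda>t. of_real (Re (F (circ t)) / m) * ((circ t + z) / (circ t - z))) = F z / of_real m"
      by (simp add: integral_unique)
    finally show ?thesis using \<open>m > 0\<close> by simp
  qed
  have "integrable lborel (\<lambda>t. p t *\<^sub>R (1::complex))"
    by (rule int) auto
  then have ip: "integrable lborel p"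
    by (simp add: scaleR_conv_of_real complex_of_real_integrable_eq)
  \<comment> \<open>At \<open>z = 0\<close> the kernel is \<open>1\<close>, so the representation
    itself computes the total mass.\<close>
  have m1: "measure M (space M) = 1"
    using S[of 0] \<open>m > 0\<close> F0 by (simp add: scaleR_conv_of_real flip: of_real_mult)
  have fin: "emeasure M (space M) < \<infinity>"
    using ip p0 unfolding M_def by (simp add: emeasure_density nn_integral_eq_integral)
  then have e1: "emeasure M (space M) = 1"
    using m1 by (metis emeasure_eq_ennreal_measure ennreal_1 infinity_ennreal_def less_irrefl)
  interpret prob_space M by standard (rule e1)
  have rd: "real_distribution M"
    by standard (auto simp: M_def)
  have "AE t in M. t \<in> {-1<..1}"
    unfolding M_def by (subst AE_density) (auto simp: p_def indicator_def)
  then have "measure M {-1<..1} = 1"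
    by (intro prob_eq_1[THEN iffD2]) (auto simp: M_def)
  then show ?thesis using that rd S by blast
qed

text \<open>The dilations \<open>f (r n * z)\<close> are holomorphic on the closed disc. Their
  measures live on one bounded interval, hence are tight and subconverge weakly; for fixed
  \<open>z\<close> the kernel is bounded and continuous in \<open>t\<close>, so the representation
  passes to the limit.\<close>

theorem Herglotz_representation:
  assumes f: "f holomorphic_on ball 0 1" and f0: "f 0 = of_real m" and "m > 0"
    and pos: "\<And>z. norm z < 1 \<Longrightarrow> Re (f z) > 0"
  obtains M where "real_distribution M"
    "\<And>z. norm z < 1 \<Longrightarrow> f z = of_real m * (\<integral>t. (circ t + z) / (circ t - z) \<partial>M)"
proof -
  \<comment> \<open>The shift by \<open>2\<close> gives \<open>r 0 = 1/2\<close>, so that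
    \<open>r n\<close> is positive from the start.\<close>
  define r where "r n = 1 - 1 / (real n + 2)" for n
  have r: "0 < r n" "r n < 1" for n
    by (auto simp: r_def field_simps)
  have r1: "r \<longlonglongrightarrow> 1"
    unfolding r_def by real_asymp
  have le: "norm (of_real (r n) * w) < 1" if "norm w \<le> 1" for n and w :: complex
  proof -
    have "norm (of_real (r n) * w) = r n * norm w" using r[of n] by (simp add: norm_mult)
    also have "\<dots> \<le> r n" using that r[of n] by (simp add: mult_left_le)
    finally show ?thesis using r(2)[of n] by linarith
  qed
  have "\<exists>M. real_distribution M \<and> measure M {-1<..1} = 1 \<and>
    (\<forall>z. norm z < 1 \<longrightarrow> f (of_real (r n) * z) = of_real m * (\<integral>t. (circ t + z) / (circ t - z) \<partial>M))" for n
  proof -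
    have hol: "(\<lambda>z. f (of_real (r n) * z)) holomorphic_on cball 0 1"
      by (rule holomorphic_on_compose_gen[OF _ f, unfolded o_def]) (use le in \<open>auto intro!: holomorphic_intros\<close>)
    show ?thesis
      by (rule Herglotz_approximation[OF hol]) (use f0 \<open>m > 0\<close> pos le in auto)
  qed
  then obtain \<mu> where \<mu>: "\<And>n. real_distribution (\<mu> n)" "\<And>n. measure (\<mu> n) {-1<..1} = 1"
    "\<And>n z. norm z < 1 \<Longrightarrow> f (of_real (r n) * z) = of_real m * (\<integral>t. (circ t + z) / (circ t - z) \<partial>\<mu> n)"
    by metis
  have "\<exists>a b::real. a < b \<and> (\<forall>n. measure (\<mu> n) {a<..b} > 1 - \<epsilon>)" if "\<epsilon> > 0" for \<epsilon>
  proof -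
    have "(-1::real) < 1 \<and> (\<forall>n. measure (\<mu> n) {-1<..1} > 1 - \<epsilon>)"
      using that \<mu>(2) by simp
    then show ?thesis by blast
  qed
  then have "tight \<mu>"
    unfolding tight_def using \<mu>(1) by blast
  from tight_imp_convergent_subsubsequence[OF this strict_mono_id]
  obtain s M where s: "strict_mono (s :: nat \<Rightarrow> nat)" and M: "real_distribution M"
    and conv: "weak_conv_m (\<mu> \<circ> id \<circ> s) M" by blast
  have "f z = of_real m * (\<integral>t. (circ t + z) / (circ t - z) \<partial>M)" if z: "norm z < 1" for z
  proof -
    let ?k = "\<lambda>t. (circ t + z) / (circ t - z)"
    have cont: "isCont ?k t" for t
      using circ_neq[OF z] continuous_on_eq_continuous_at[of UNIV circ]
      by (intro continuous_intros) (auto intro: continuous_on_circ)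
    have bd: "norm (?k t) \<le> 2 / (1 - norm z)" for t
    proof -
      have "norm (circ t + z) \<le> 2" using norm_triangle_ineq[of "circ t" z] z by simp
      moreover have "norm (circ t - z) \<ge> 1 - norm z" using norm_triangle_ineq2[of "circ t" z] by simp
      ultimately show ?thesis unfolding norm_divide using z by (intro frac_le) auto
    qed
    have "(\<lambda>n. \<integral>t. ?k t \<partial>(\<mu> \<circ> id \<circ> s) n) \<longlonglongrightarrow> (\<integral>t. ?k t \<partial>M)"
      by (rule weak_conv_imp_integral_bdd_continuous_conv[OF _ M conv cont bd]) (use \<mu> in auto)
    then have "(\<lambda>n. of_real m * (\<integral>t. ?k t \<partial>\<mu> (s n))) \<longlonglongrightarrow> of_real m * (\<integral>t. ?k t \<partial>M)"
      by (intro tendsto_intros) simp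
    then have L1: "(\<lambda>n. f (of_real (r (s n)) * z)) \<longlonglongrightarrow> of_real m * (\<integral>t. ?k t \<partial>M)"
      using \<mu>(3)[OF z] by simp
    have "(\<lambda>n. complex_of_real (r (s n)) * z) \<longlonglongrightarrow> of_real 1 * z"
      using LIMSEQ_subseq_LIMSEQ[OF r1 s] by (intro tendsto_intros) (simp add: o_def)
    moreover have "isCont f z"
      using holomorphic_on_imp_continuous_on[OF f] z by (simp add: continuous_on_eq_continuous_at)
    ultimately have "(\<lambda>n. f (of_real (r (s n)) * z)) \<longlonglongrightarrow> f z"
      using isCont_tendsto_compose[of z f] by simp
    then show ?thesis using L1 LIMSEQ_unique by blast
  qed
  then show ?thesis using that M by blast
qed

text \<open>Expanding the kernel at \<open>z = 0\<close> to first order shows that the derivative of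
  \<open>f\<close> at \<open>0\<close> is \<open>2 * m\<close> times the integral of
  \<open>cnj (circ t)\<close>.\<close>

lemma Herglotz_first_moment:
  assumes M: "real_distribution M"
    and f: "\<And>z. norm z < 1 \<Longrightarrow> f z = of_real m * (\<integral>t. (circ t + z) / (circ t - z) \<partial>M)"
    and d: "(f has_field_derivative 0) (at 0)" and "m \<noteq> 0"
  shows "(\<integral>t. circ t \<partial>M) = 0"
proof -
  interpret real_distribution M by fact
  let ?R = "\<lambda>z. \<integral>t. cnj (circ t) / (circ t - z) \<partial>M"
  \<comment> \<open>Restricting to \<open>norm z < 1/2\<close> keeps the denominator at least
    \<open>1/2\<close>, so the remainder is bounded uniformly in \<open>t\<close> and
    \<open>z\<close>.\<close>
  have ib: "norm (cnj (circ t) / (circ t - z)) \<le> 2" if "norm z < 1/2" for t z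
  proof -
    have "norm (circ t - z) \<ge> 1/2" using norm_triangle_ineq2[of "circ t" z] that by simp
    then have "1 / norm (circ t - z) \<le> 1 / (1/2)" by (intro divide_left_mono) auto
    then show ?thesis by (simp add: norm_divide)
  qed
  have i1: "integrable M (\<lambda>t. cnj (circ t) / (circ t - z))" if "norm z < 1/2" for z
  proof (rule integrable_const_bound[of _ 2])
    have "continuous_on UNIV (\<lambda>t. cnj (circ t) / (circ t - z))"
      using that circ_neq[of z] by (intro continuous_intros) auto
    then show "(\<lambda>t. cnj (circ t) / (circ t - z)) \<in> borel_measurable M"
      by (simp add: borel_measurable_continuous_onI)
  qed (use ib[OF that] in auto)
  have i2: "integrable M (\<lambda>t. cnj (circ t))"
  proof (rule integrable_const_bound[of _ 1])
    have "continuous_on UNIV (\<lambda>t. cnj (circ t))"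
      by (intro continuous_intros)
    then show "(\<lambda>t. cnj (circ t)) \<in> borel_measurable M"
      by (simp add: borel_measurable_continuous_onI)
  qed auto
  have e: "f z = of_real m * (1 + 2 * z * (\<integral>t. cnj (circ t) \<partial>M) + 2 * z^2 * ?R z)" if z: "norm z < 1/2" for z
  proof -
    have "(circ t + z) / (circ t - z) = 1 + 2 * z * cnj (circ t) + 2 * z^2 * (cnj (circ t) / (circ t - z))" for t
    proof -
      show ?thesis
        using circ_neq[of z t] z by (simp add: cnj_circ field_simps power2_eq_square)
    qed
    then have "(\<integral>t. (circ t + z) / (circ t - z) \<partial>M) = (\<integral>t. 1 + 2 * z * cnj (circ t) + 2 * z^2 * (cnj (circ t) / (circ t - z)) \<partial>M)"
      by presburger
    also have "\<dots> = (\<integral>t. 1 + 2 * z * cnj (circ t) \<partial>M) + (\<integral>t. 2 * z^2 * (cnj (circ t) / (circ t - z)) \<partial>M)"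
      using i1[OF z] i2
      by (intro Bochner_Integration.integral_add Bochner_Integration.integrable_add integrable_mult_right) auto
    also have "(\<integral>t. 1 + 2 * z * cnj (circ t) \<partial>M) = (\<integral>t. 1 \<partial>M) + (\<integral>t. 2 * z * cnj (circ t) \<partial>M)"
      using i1[OF z] i2
      by (intro Bochner_Integration.integral_add Bochner_Integration.integrable_add integrable_mult_right) auto
    finally show ?thesis using f[of z] z by (simp add: prob_space[simplified] del: times_divide_eq_right)
  qed
  have "((\<lambda>z. (f z - f 0) / (z - 0)) \<longlongrightarrow> 0) (at 0)"
    using d by (simp add: has_field_derivative_iff)
  moreover have "((\<lambda>z. (f z - f 0) / (z - 0)) \<longlongrightarrow> of_real m * (2 * (\<integral>t. cnj (circ t) \<partial>M) + 0)) (at 0)"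
  proof (rule Lim_transform_eventually)
    have "((\<lambda>z. 2 * z * ?R z) \<longlongrightarrow> 0) (at 0)"
    proof (rule tendsto_0_le[of "\<lambda>z. z" _ _ 4])
      show "\<forall>\<^sub>F z in at 0. norm (2 * z * ?R z) \<le> norm z * 4"
        unfolding eventually_at
      proof (intro exI[of _ "1/2"] conjI ballI impI)
        fix z :: complex assume "z \<noteq> 0 \<and> dist z 0 < 1 / 2"
        then have z: "norm z < 1/2" by simp
        have "norm (?R z) \<le> (\<integral>t. norm (cnj (circ t) / (circ t - z)) \<partial>M)"
          by (rule integral_norm_bound)
        also have "\<dots> \<le> (\<integral>t. 2 \<partial>M)"
          using i1[OF z] ib[OF z] by (intro integral_mono) auto
        finally have "norm (?R z) \<le> 2" by (simp add: prob_space[simplified])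
        then show "norm (2 * z * ?R z) \<le> norm z * 4"
          using mult_left_mono[of "norm (?R z)" 2 "2 * norm z"] by (simp add: norm_mult)
      qed auto
    qed (rule tendsto_ident_at)
    then show "((\<lambda>z. of_real m * (2 * (\<integral>t. cnj (circ t) \<partial>M) + 2 * z * ?R z)) \<longlongrightarrow> of_real m * (2 * (\<integral>t. cnj (circ t) \<partial>M) + 0)) (at 0)"
      by (intro tendsto_intros)
    show "\<forall>\<^sub>F z in at 0. of_real m * (2 * (\<integral>t. cnj (circ t) \<partial>M) + 2 * z * ?R z) = (f z - f 0) / (z - 0)"
      unfolding eventually_at
    proof (intro exI[of _ "1/2"] conjI ballI impI)
      fix z :: complex assume "z \<noteq> 0 \<and> dist z 0 < 1 / 2"
      then show "of_real m * (2 * (\<integral>t. cnj (circ t) \<partial>M) + 2 * z * ?R z) = (f z - f 0) / (z - 0)"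
        using e[of z] e[of 0] by (simp add: field_simps power2_eq_square)
    qed auto
  qed
  ultimately have "of_real m * (2 * (\<integral>t. cnj (circ t) \<partial>M) + 0) = 0"
    using tendsto_unique[OF at_neq_bot] by blast
  then have "(\<integral>t. cnj (circ t) \<partial>M) = 0"
    using \<open>m \<noteq> 0\<close> by simp
  then show ?thesis by (metis Bochner_Integration.integral_cnj complex_cnj_zero_iff)
qed

section \<open>Crossing numbers of rays\<close>

definition cdet :: "complex \<Rightarrow> complex \<Rightarrow> real" where
  "cdet x y = Re x * Im y - Im x * Re y"

lemma cdet_swap: "cdet y x = - cdet x y"
  by (simp add: cdet_def)

lemma cdet_minus [simp]: "cdet (-x) y = - cdet x y" "cdet x (-y) = - cdet x y"
  by (simp_all add: cdet_def)

lemma cdet_self [simp]: "cdet x x = 0"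
  by (simp add: cdet_def)

lemma abs_cdet_le: "\<bar>cdet x y\<bar> \<le> norm x * norm y"
proof -
  have "cdet x y = Im (cnj x * y)" by (simp add: cdet_def)
  then show ?thesis using abs_Im_le_cmod[of "cnj x * y"] by (simp add: norm_mult)
qed

text \<open>The three-term Pluecker relation. It turns positivity of \<open>cdet a b\<close> and
  \<open>cdet x y\<close> into the hypothesis of \<open>both_pos_crossing\<close>.\<close>

lemma cdet_Plucker: "cdet a b * cdet x y = cdet a x * cdet b y - cdet a y * cdet b x"
  by (simp add: cdet_def algebra_simps)

text \<open>Cramer's rule for three vectors of the plane; it is the source of the barycentric
  coordinates of \<open>0\<close>.\<close>

lemma cdet_relation:
  "of_real (cdet x y) * w + of_real (cdet y w) * x + of_real (cdet w x) * y = 0"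
  by (rule complex_eqI) (simp_all add: cdet_def algebra_simps)

text \<open>The number \<open>cnj x * y\<close> is real of modulus \<open>1\<close>, hence
  \<open>1\<close> or \<open>-1\<close>.\<close>

lemma cdet_eq_0_unit:
  assumes "norm x = 1" "norm y = 1" "cdet x y = 0"
  shows "y = x \<or> y = - x"
proof -
  have "cnj x * y = of_real (Re (cnj x * y))"
    using assms(3) by (intro complex_eqI) (auto simp: cdet_def)
  moreover have "norm (cnj x * y) = 1" using assms by (simp add: norm_mult)
  ultimately have "\<bar>Re (cnj x * y)\<bar> = 1" by (metis norm_of_real)
  then have "cnj x * y = 1 \<or> cnj x * y = -1"
    using \<open>cnj x * y = of_real (Re (cnj x * y))\<close> by (metis abs_eq_iff' abs_one of_real_1 of_real_minus)
  moreover have "x * (cnj x * y) = y"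
    using assms(1) by (simp add: complex_norm_square[symmetric] flip: mult.assoc)
  ultimately show ?thesis by (metis mult.right_neutral mult_minus1_right)
qed

text \<open>Boundary rays get half weight; this is what makes the crossing counts below additive
  even when several of the vectors are collinear.\<close>

definition both_pos :: "real \<Rightarrow> real \<Rightarrow> real" where
  "both_pos p q = (of_bool (p > 0 \<and> q > 0) + of_bool (p \<ge> 0 \<and> q \<ge> 0)) / 2"

lemma both_pos_bounds: "0 \<le> both_pos p q" "both_pos p q \<le> 1"
  by (auto simp: both_pos_def)

text \<open>Only signs matter: the hypothesis excludes \<open>q * r \<ge> 0\<close> together with
  \<open>p * s \<le> 0\<close>, and the remaining sign patterns are checked one by one.\<close>

lemma both_pos_crossing:
  assumes "q * r < p * s"
  shows "both_pos p (- q) - both_pos r (- s) = both_pos (- q) s - both_pos (- p) r"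
proof -
  have "\<not> (q * r \<ge> 0 \<and> p * s \<le> 0)" using assms by linarith
  then show ?thesis
    using assms
    by (cases p "0::real" rule: linorder_cases; cases q "0::real" rule: linorder_cases;
        cases r "0::real" rule: linorder_cases; cases s "0::real" rule: linorder_cases)
       (auto simp: both_pos_def zero_le_mult_iff mult_le_0_iff)
qed

text \<open>If \<open>cdet x y > 0\<close>, then \<open>cdet y a\<close> and \<open>cdet a x\<close>
  are, up to the factor \<open>cdet x y\<close>, the coordinates of \<open>-a\<close> in the basis
  \<open>x, y\<close>. So the first factor tests whether \<open>-a\<close> lies in the cone spanned
  by \<open>x\<close> and \<open>y\<close>.\<close>

definition cone_weight :: "complex \<Rightarrow> complex \<Rightarrow> complex \<Rightarrow> real" where
  "cone_weight a x y = both_pos (cdet a x) (cdet y a) * max 0 (cdet x y)"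

lemma cone_weight_nonneg: "cone_weight a x y \<ge> 0"
  by (simp add: cone_weight_def both_pos_bounds)

lemma cone_weight_le: "norm x = 1 \<Longrightarrow> norm y = 1 \<Longrightarrow> cone_weight a x y \<le> 1"
  using abs_cdet_le[of x y] mult_mono[of "both_pos (cdet a x) (cdet y a)" 1 "max 0 (cdet x y)" 1]
  by (auto simp: cone_weight_def both_pos_bounds)

text \<open>The oriented arc from \<open>x\<close> to \<open>y\<close> crosses the rays through \<open>-a\<close> and \<open>-b\<close> equally often,
  up to the change along it of the indicator function of the sector between these rays.\<close>

lemma cone_weight_diff:
  assumes "cdet a b > 0"
  shows "(cone_weight a x y + cone_weight a y x) - (cone_weight b x y + cone_weight b y x)
    = (both_pos (- cdet a y) (cdet b y) - both_pos (- cdet a x) (cdet b x)) * cdet x y"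
proof -
  \<comment> \<open>Both sides are symmetric in \<open>x\<close> and \<open>y\<close> and vanish if
    \<open>cdet x y = 0\<close>, so one orientation suffices.\<close>
  have *: "(cone_weight a x y + cone_weight a y x) - (cone_weight b x y + cone_weight b y x)
    = (both_pos (- cdet a y) (cdet b y) - both_pos (- cdet a x) (cdet b x)) * cdet x y"
    if "cdet x y > 0" for x y
  proof -
    have "cdet a y * cdet b x < cdet a x * cdet b y"
      using cdet_Plucker[of a b x y] mult_pos_pos[OF assms that] by linarith
    from both_pos_crossing[OF this] show ?thesis
      using that by (simp add: cone_weight_def cdet_swap[of _ a] cdet_swap[of _ b] cdet_swap[of y x]
        flip: left_diff_distrib)
  qed
  consider "cdet x y > 0" | "cdet y x > 0" | "cdet x y = 0"
    by (metis cdet_swap linorder_neqE neg_0_less_iff_less)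
  then show ?thesis
  proof cases
    case 2
    from *[OF 2] show ?thesis by (simp add: cdet_swap[of x y] algebra_simps)
  next
    case 3
    then show ?thesis by (simp add: cone_weight_def cdet_swap[of x y])
  qed (rule *)
qed

text \<open>Averages the open and the closed condition, to match the half weights in
  \<open>both_pos\<close>. Unlike \<open>cone_weight\<close> it treats the three vertices
  alike.\<close>

definition triangle_weight :: "complex \<Rightarrow> complex \<Rightarrow> complex \<Rightarrow> real" where
  "triangle_weight a x y =
    (of_bool (cdet a x > 0 \<and> cdet x y > 0 \<and> cdet y a > 0)
     + of_bool (cdet a x \<ge> 0 \<and> cdet x y \<ge> 0 \<and> cdet y a \<ge> 0)) / 2"

lemma triangle_weight_rotate: "triangle_weight x y a = triangle_weight a x y"
  by (auto simp: triangle_weight_def)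

text \<open>The two weights impose the same conditions on \<open>a\<close> once
  \<open>cdet x y > 0\<close>; otherwise both sides vanish.\<close>

lemma triangle_weight_cdet: "triangle_weight a x y * cdet x y = cone_weight a x y"
  by (auto simp: triangle_weight_def cone_weight_def both_pos_def max_def)

section \<open>Barycentric measures in the weak-* topology\<close>

definition theta_borel :: "circ_meas measure" where
  "theta_borel = sigma ThetaHat {U. openin weakstar_top U}"

text \<open>All of \<open>ThetaHat\<close> is a subbasic set, given by the zero function and
  \<open>U = UNIV\<close>.\<close>

lemma topspace_weakstar_top: "topspace weakstar_top = ThetaHat"
proof -
  have "{p \<in> ThetaHat. pair_w p (\<lambda>_. 0::real) \<in> UNIV} \<in> {{p \<in> ThetaHat. pair_w p g \<in> U} | g U.
        continuous_on unit_circle (g :: complex \<Rightarrow> real) \<and> open U}"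
    using continuous_on_const open_UNIV by blast
  then show ?thesis
    unfolding weakstar_top_def topology_generated_by_topspace by blast
qed

lemma space_theta_borel [simp]: "space theta_borel = ThetaHat"
  and sets_theta_borel: "sets theta_borel = borel_sets_of weakstar_top"
proof -
  have "{U. openin weakstar_top U} \<subseteq> Pow ThetaHat"
    using openin_subset topspace_weakstar_top by blast
  then show "space theta_borel = ThetaHat" "sets theta_borel = borel_sets_of weakstar_top"
    by (simp_all add: theta_borel_def borel_sets_of_def topspace_weakstar_top)
qed

lemma measurable_theta_borelI:
  assumes "\<And>x. x \<in> space M \<Longrightarrow> \<Psi> x \<in> ThetaHat"
    and "\<And>U. openin weakstar_top U \<Longrightarrow> \<Psi> -` U \<inter> space M \<in> sets M"
  shows "\<Psi> \<in> M \<rightarrow>\<^sub>M theta_borel"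
  unfolding theta_borel_def
  using assms openin_subset[of weakstar_top] topspace_weakstar_top by (intro measurable_measure_of) auto

lemma measurable_pair_w_real:
  assumes "continuous_on unit_circle (g :: complex \<Rightarrow> real)"
  shows "(\<lambda>\<theta>. pair_w \<theta> g) \<in> borel_measurable theta_borel"
proof (rule borel_measurableI)
  fix U :: "real set" assume "open U"
  then have "openin weakstar_top {p \<in> ThetaHat. pair_w p g \<in> U}"
    unfolding weakstar_top_def using assms by (intro topology_generated_by_Basis) blast
  moreover have "(\<lambda>\<theta>. pair_w \<theta> g) -` U \<inter> space theta_borel = {p \<in> ThetaHat. pair_w p g \<in> U}"
    by auto
  ultimately show "(\<lambda>\<theta>. pair_w \<theta> g) -` U \<inter> space theta_borel \<in> sets theta_borel"
    by (simp add: sets_theta_borel borel_sets_of_def sigma_sets.Basic)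
qed

lemma measurable_pair_w:
  assumes "continuous_on unit_circle (g :: complex \<Rightarrow> complex)"
  shows "(\<lambda>\<theta>. pair_w \<theta> g) \<in> borel_measurable theta_borel"
proof -
  have "(\<lambda>\<theta>. pair_w \<theta> (\<lambda>w. Re (g w))) \<in> borel_measurable theta_borel"
       "(\<lambda>\<theta>. pair_w \<theta> (\<lambda>w. Im (g w))) \<in> borel_measurable theta_borel"
    by (intro measurable_pair_w_real continuous_intros assms)+
  then have "(\<lambda>\<theta>. Complex (pair_w \<theta> (\<lambda>w. Re (g w))) (pair_w \<theta> (\<lambda>w. Im (g w)))) \<in> borel_measurable theta_borel"
    by (simp add: borel_measurable_complex_iff)
  moreover have "Complex (pair_w \<theta> (\<lambda>w. Re (g w))) (pair_w \<theta> (\<lambda>w. Im (g w))) = pair_w \<theta> g" for \<theta>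
    by (rule complex_eqI) (simp_all add: pair_w_def)
  ultimately show ?thesis by simp
qed

section \<open>Two-point measures and barycentric measures of triangles around
  \<open>0\<close>\<close>

lemma pair_w_superset:
  assumes "finite S" "supp_w p \<subseteq> S"
  shows "pair_w p g = (\<Sum>w\<in>S. p w *\<^sub>R g w)"
  unfolding pair_w_def using assms by (intro sum.mono_neutral_left) (auto simp: supp_w_def)

lemma pair_w_two_point: "norm a = 1 \<Longrightarrow> pair_w (two_point a) g = (1/2) *\<^sub>R (g a + g (- a))"
proof -
  assume "norm a = 1"
  then have "a \<noteq> - a" by auto
  moreover have "pair_w (two_point a) g = (\<Sum>w\<in>{a, - a}. two_point a w *\<^sub>R g w)"
    by (rule pair_w_superset) (auto simp: supp_w_def two_point_def)
  ultimately show ?thesis by (simp add: two_point_def scaleR_add_right)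
qed

text \<open>The weights are the coefficients of \<open>cdet_relation\<close> divided by their sum,
  that is, the barycentric coordinates of \<open>0\<close>.\<close>

definition bary :: "complex \<Rightarrow> complex \<Rightarrow> complex \<Rightarrow> circ_meas" where
  "bary a x y = (let \<sigma> = cdet x y + cdet y a + cdet a x
     in three_point a x y (cdet x y / \<sigma>) (cdet y a / \<sigma>) (cdet a x / \<sigma>))"

text \<open>The weak inequalities admit triangles with \<open>0\<close> on an edge, which produce
  the two-point measures; the positive sum makes the normalisation in \<open>bary\<close>
  possible.\<close>

definition around_zero :: "complex \<Rightarrow> complex \<Rightarrow> complex \<Rightarrow> bool" where
  "around_zero a x y \<longleftrightarrow> cdet a x \<ge> 0 \<and> cdet x y \<ge> 0 \<and> cdet y a \<ge> 0 \<and> cdet x y + cdet y a + cdet a x > 0"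

text \<open>If two vertices coincide, one determinant is \<open>0\<close> and the other two are
  opposite, so the sum is \<open>0\<close>.\<close>

lemma around_zero_distinct:
  assumes "around_zero a x y"
  shows "a \<noteq> x" "a \<noteq> y" "x \<noteq> y"
  using assms cdet_swap[of a x] cdet_swap[of a y] cdet_swap[of x y] by (auto simp: around_zero_def)

lemma pair_w_bary:
  fixes g :: "complex \<Rightarrow> 'b::real_vector"
  assumes "around_zero a x y"
  shows "pair_w (bary a x y) g = (1 / (cdet x y + cdet y a + cdet a x)) *\<^sub>R
    (cdet x y *\<^sub>R g a + cdet y a *\<^sub>R g x + cdet a x *\<^sub>R g y)"
proof -
  note d = around_zero_distinct[OF assms]
  have "pair_w (bary a x y) g = (\<Sum>w\<in>{a, x, y}. bary a x y w *\<^sub>R g w)"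
    by (rule pair_w_superset) (auto simp: supp_w_def bary_def Let_def three_point_def)
  then show ?thesis
    using d by (simp add: bary_def Let_def three_point_def scaleR_add_right)
qed

text \<open>A vanishing determinant makes two distinct unit vectors antipodal. The other two
  determinants are then equal, and the antipodal points get weight \<open>1/2\<close> each.\<close>

lemma bary_degenerate:
  assumes n: "norm a = 1" "norm x = 1" "norm y = 1" and z: "around_zero a x y"
  shows "cdet x y = 0 \<Longrightarrow> bary a x y = two_point x"
    and "cdet y a = 0 \<Longrightarrow> bary a x y = two_point y"
    and "cdet a x = 0 \<Longrightarrow> bary a x y = two_point a"
proof -
  note d = around_zero_distinct[OF z]
  show "bary a x y = two_point x" if "cdet x y = 0"
  proof -
    have "y = - x" using cdet_eq_0_unit[OF n(2,3) that] d by auto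
    then show ?thesis using z d cdet_swap[of x a]
      by (auto simp: bary_def Let_def three_point_def two_point_def around_zero_def fun_eq_iff)
  qed
  show "bary a x y = two_point y" if "cdet y a = 0"
  proof -
    have "a = - y" using cdet_eq_0_unit[OF n(3,1) that] d by auto
    then show ?thesis using z d cdet_swap[of x y]
      by (auto simp: bary_def Let_def three_point_def two_point_def around_zero_def fun_eq_iff)
  qed
  show "bary a x y = two_point a" if "cdet a x = 0"
  proof -
    have "x = - a" using cdet_eq_0_unit[OF n(1,2) that] d by auto
    then show ?thesis using z d cdet_swap[of a y]
      by (auto simp: bary_def Let_def three_point_def two_point_def around_zero_def fun_eq_iff)
  qed
qed

text \<open>The sum is twice the signed area of the triangle.\<close>

lemma not_collinear_cdet:
  assumes "cdet x y + cdet y a + cdet a x \<noteq> 0"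
  shows "\<not> collinear {a, x, y}"
proof
  assume "collinear {a, x, y}"
  then consider "a = y" | u where "x = u *\<^sub>R a + (1 - u) *\<^sub>R y"
    unfolding collinear_3_expand by blast
  then show False
    using assms by cases (auto simp: cdet_def algebra_simps)
qed

lemma bary_in_ThetaHat:
  assumes n: "norm a = 1" "norm x = 1" "norm y = 1" and z: "around_zero a x y"
  shows "bary a x y \<in> ThetaHat"
proof (cases "cdet a x > 0 \<and> cdet x y > 0 \<and> cdet y a > 0")
  case True
  define s where "s = cdet x y + cdet y a + cdet a x"
  have s: "s > 0" using True by (simp add: s_def)
  have sum1: "cdet x y / s + cdet y a / s + cdet a x / s = 1"
    using s by (simp add: s_def flip: add_divide_distrib)
  have "(cdet x y / s) *\<^sub>R a + (cdet y a / s) *\<^sub>R x + (cdet a x / s) *\<^sub>R y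
     = (of_real (cdet x y) * a + of_real (cdet y a) * x + of_real (cdet a x) * y) / of_real s"
    by (simp add: scaleR_conv_of_real add_divide_distrib)
  then have sum0: "(cdet x y / s) *\<^sub>R a + (cdet y a / s) *\<^sub>R x + (cdet a x / s) *\<^sub>R y = 0"
    by (simp add: cdet_relation)
  have "0 \<in> interior (convex hull {a, x, y})"
  proof -
    have "\<not> collinear {a, x, y}"
      using s not_collinear_cdet[of x y a] by (simp add: s_def)
    moreover have "0 < cdet x y / s" "0 < cdet y a / s" "0 < cdet a x / s"
      using True s by auto
    ultimately show ?thesis
      using sum1 sum0 by (subst interior_convex_hull_3_minimal) (simp, simp, blast)
  qed
  moreover have "bary a x y = three_point a x y (cdet x y / s) (cdet y a / s) (cdet a x / s)"
    by (simp add: bary_def s_def Let_def)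
  moreover have "of_real (cdet x y / s) * a + of_real (cdet y a / s) * x + of_real (cdet a x / s) * y = 0"
    using sum0 by (simp only: scaleR_conv_of_real)
  moreover have "a \<in> unit_circle" "x \<in> unit_circle" "y \<in> unit_circle"
    using n by (simp_all add: unit_circle_def)
  ultimately show ?thesis
    unfolding ThetaHat_def using around_zero_distinct[OF z] sum1 by blast
next
  case False
  then have "cdet a x = 0 \<or> cdet x y = 0 \<or> cdet y a = 0"
    using z by (auto simp: around_zero_def)
  then have "bary a x y = two_point x \<or> bary a x y = two_point y \<or> bary a x y = two_point a"
    using bary_degenerate[OF assms] by blast
  then show ?thesis
    using n by (auto simp: ThetaHat_def unit_circle_def)
qed

section \<open>Decomposition of centred measures\<close>

lemma continuous_on_cdet [continuous_intros]:
  "continuous_on S f \<Longrightarrow> continuous_on S g \<Longrightarrow> continuous_on S (\<lambda>p. cdet (f p) (g p))"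
  unfolding cdet_def by (intro continuous_intros)

lemma continuous_on_circ_comp [continuous_intros]:
  "continuous_on S f \<Longrightarrow> continuous_on S (\<lambda>p. circ (f p))"
  by (rule continuous_on_compose2[OF continuous_on_circ[of UNIV]]) auto

text \<open>The default \<open>two_point 1\<close> only keeps the map inside
  \<open>ThetaHat\<close>; triples that receive it carry no weight in the mixture.\<close>

definition bary_circ :: "real \<times> real \<times> real \<Rightarrow> circ_meas" where
  "bary_circ = (\<lambda>(s, t, u). if around_zero (circ s) (circ t) (circ u)
     then bary (circ s) (circ t) (circ u) else two_point 1)"

lemma bary_circ_in_ThetaHat: "bary_circ p \<in> ThetaHat"
proof -
  have "two_point 1 \<in> ThetaHat"
    by (auto simp: ThetaHat_def unit_circle_def)
  then show ?thesis
    by (auto simp: bary_circ_def bary_in_ThetaHat split: prod.split)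
qed

text \<open>On the Borel set \<open>X\<close> the map is weak-* continuous, since its pairings are
  quotients of continuous functions with positive denominator; off \<open>X\<close> it is constant.
  Going through continuity reaches every open set from the subbasic ones without a countable
  base.\<close>

lemma measurable_bary_circ: "bary_circ \<in> borel \<rightarrow>\<^sub>M theta_borel"
proof (rule measurable_theta_borelI)
  define X where "X = {p. around_zero (circ (fst p)) (circ (fst (snd p))) (circ (snd (snd p)))}"
  let ?a = "\<lambda>p::real \<times> real \<times> real. circ (fst p)"
  let ?x = "\<lambda>p::real \<times> real \<times> real. circ (fst (snd p))"
  let ?y = "\<lambda>p::real \<times> real \<times> real. circ (snd (snd p))"
  let ?s = "\<lambda>p. cdet (?x p) (?y p) + cdet (?y p) (?a p) + cdet (?a p) (?x p)"
  have Xeq: "X = {p. 0 \<le> cdet (?a p) (?x p)} \<inter> {p. 0 \<le> cdet (?x p) (?y p)}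
      \<inter> {p. 0 \<le> cdet (?y p) (?a p)} \<inter> {p. 0 < ?s p}"
    by (auto simp: X_def around_zero_def)
  have X: "X \<in> sets borel"
    unfolding Xeq
    by (intro sets.Int borel_closed borel_open closed_Collect_le open_Collect_less continuous_intros)
  have cont: "continuous_map (top_of_set X) weakstar_top bary_circ"
    unfolding weakstar_top_def
  proof (rule continuous_on_generated_topo)
    have "bary_circ ` topspace (top_of_set X) \<subseteq> topspace weakstar_top"
      using bary_circ_in_ThetaHat topspace_weakstar_top by auto
    then show "bary_circ ` topspace (top_of_set X) \<subseteq> \<Union> {{p \<in> ThetaHat. pair_w p g \<in> U} | g U.
        continuous_on unit_circle (g :: complex \<Rightarrow> real) \<and> open U}"
      by (simp only: weakstar_top_def topology_generated_by_topspace)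
    fix V assume "V \<in> {{p \<in> ThetaHat. pair_w p g \<in> U} | g U.
        continuous_on unit_circle (g :: complex \<Rightarrow> real) \<and> open U}"
    then obtain g :: "complex \<Rightarrow> real" and U where V: "V = {p \<in> ThetaHat. pair_w p g \<in> U}"
      and g: "continuous_on unit_circle g" and U: "open U" by blast
    have gc: "continuous_on X (\<lambda>p. g (circ (f p)))" if "continuous_on X f" for f
      by (rule continuous_on_compose2[OF g]) (auto simp: unit_circle_def intro!: continuous_intros that)
    define G where "G p = (1 / ?s p) *\<^sub>R (cdet (?x p) (?y p) *\<^sub>R g (?a p)
        + cdet (?y p) (?a p) *\<^sub>R g (?x p) + cdet (?a p) (?x p) *\<^sub>R g (?y p))" for p
    have "continuous_on X G"
      unfolding G_def by (intro continuous_intros gc) (auto simp: Xeq)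
    then have "openin (top_of_set X) (X \<inter> G -` U)"
      using U by (rule continuous_openin_preimage_gen)
    moreover have "pair_w (bary_circ p) g = G p" if "p \<in> X" for p
      using that pair_w_bary[of "?a p" "?x p" "?y p" g] by (simp add: X_def G_def bary_circ_def split_beta)
    then have "bary_circ -` V \<inter> topspace (top_of_set X) = X \<inter> G -` U"
      using bary_circ_in_ThetaHat by (auto simp: V)
    ultimately show "openin (top_of_set X) (bary_circ -` V \<inter> topspace (top_of_set X))"
      by simp
  qed
  fix U assume "openin weakstar_top U"
  then have "openin (top_of_set X) {p \<in> X. bary_circ p \<in> U}"
    using cont openin_continuous_map_preimage by fastforce
  then obtain W where W: "open W" "{p \<in> X. bary_circ p \<in> U} = X \<inter> W"
    unfolding openin_open by blast
  have "bary_circ p = two_point 1" if "p \<notin> X" for p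
    using that by (simp add: bary_circ_def X_def split_beta)
  moreover have "bary_circ p \<in> U \<longleftrightarrow> p \<in> W" if "p \<in> X" for p
    using that W(2) by blast
  ultimately have "p \<in> bary_circ -` U \<inter> space borel \<longleftrightarrow>
      p \<in> (X \<inter> W) \<union> (if two_point 1 \<in> U then - X else {})" for p
    by (cases "p \<in> X") simp_all
  then have "bary_circ -` U \<inter> space borel = (X \<inter> W) \<union> (if two_point 1 \<in> U then - X else {})"
    by blast
  also have "\<dots> \<in> sets borel"
    using X W(1) by auto
  finally show "bary_circ -` U \<inter> space borel \<in> sets borel" .
qed (rule bary_circ_in_ThetaHat)

lemma measurable_cdet [measurable (raw)]:
  assumes [measurable]: "f \<in> borel_measurable M" "g \<in> borel_measurable M"
  shows "(\<lambda>p. cdet (f p) (g p)) \<in> borel_measurable M"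
  unfolding cdet_def by measurable

lemma measurable_both_pos [measurable (raw)]:
  assumes [measurable]: "f \<in> borel_measurable M" "g \<in> borel_measurable M"
  shows "(\<lambda>p. both_pos (f p) (g p)) \<in> borel_measurable M"
  unfolding both_pos_def of_bool_def by measurable

lemma measurable_cone_weight [measurable (raw)]:
  assumes [measurable]: "f \<in> borel_measurable M" "g \<in> borel_measurable M" "h \<in> borel_measurable M"
  shows "(\<lambda>p. cone_weight (f p) (g p) (h p)) \<in> borel_measurable M"
  unfolding cone_weight_def by measurable

lemma measurable_triangle_weight [measurable (raw)]:
  assumes [measurable]: "f \<in> borel_measurable M" "g \<in> borel_measurable M" "h \<in> borel_measurable M"
  shows "(\<lambda>p. triangle_weight (f p) (g p) (h p)) \<in> borel_measurable M"
  unfolding triangle_weight_def of_bool_def by measurable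

lemma measurable_circ [measurable]: "circ \<in> borel_measurable borel"
  by (intro borel_measurable_continuous_onI continuous_on_circ)

section \<open>Cone masses of a centred distribution and their independence of the direction\<close>

locale centered_distribution = real_distribution M for M +
  assumes centered: "(\<integral>t. circ t \<partial>M) = 0"
begin

sublocale PP: pair_prob_space M M ..

sublocale PPP: pair_prob_space M "M \<Otimes>\<^sub>M M" ..

lemma integrable_circ [simp]: "integrable M circ"
  by (rule integrable_const_bound[of _ 1]) auto

lemma integral_cdet_circ: "(\<integral>s. cdet (circ s) y \<partial>M) = 0"
proof -
  have "(\<integral>s. cdet (circ s) y \<partial>M) = cdet (\<integral>s. circ s \<partial>M) y"
    unfolding cdet_def by (subst Bochner_Integration.integral_diff) auto
  then show ?thesis by (simp add: centered cdet_def)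
qed

lemma abs_cdet_circ_le: "\<bar>cdet (circ s) (circ t)\<bar> \<le> 1"
  using abs_cdet_le[of "circ s" "circ t"] by simp

text \<open>The weight depends on \<open>t\<close> only. Integrating over \<open>s\<close> first
  gives \<open>0\<close>, by linearity of \<open>cdet\<close> and centredness.\<close>

lemma integral_weight_cdet:
  fixes k :: "complex \<Rightarrow> real"
  assumes [measurable]: "k \<in> borel_measurable borel" and k: "\<And>x. \<bar>k x\<bar> \<le> 1"
  shows "integrable (M \<Otimes>\<^sub>M M) (\<lambda>(s, t). k (circ t) * cdet (circ s) (circ t))"
    and "(\<integral>(s, t). k (circ t) * cdet (circ s) (circ t) \<partial>(M \<Otimes>\<^sub>M M)) = 0"
proof -
  show I: "integrable (M \<Otimes>\<^sub>M M) (\<lambda>(s, t). k (circ t) * cdet (circ s) (circ t))"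
  proof (rule PP.integrable_const_bound[of _ 1])
    show "AE p in M \<Otimes>\<^sub>M M. norm (case p of (s, t) \<Rightarrow> k (circ t) * cdet (circ s) (circ t)) \<le> 1"
      using k abs_cdet_circ_le by (intro AE_I2) (auto simp: abs_mult intro!: mult_le_one)
  qed measurable
  show "(\<integral>(s, t). k (circ t) * cdet (circ s) (circ t) \<partial>(M \<Otimes>\<^sub>M M)) = 0"
    by (subst PP.integral_snd[OF I, symmetric]) (simp add: integral_cdet_circ)
qed

definition cone_mass :: "complex \<Rightarrow> real" where
  "cone_mass a = (\<integral>(s, t). cone_weight a (circ s) (circ t) \<partial>(M \<Otimes>\<^sub>M M))"

lemma integrable_cone_weight: "integrable (M \<Otimes>\<^sub>M M) (\<lambda>(s, t). cone_weight a (circ s) (circ t))"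
proof (rule PP.integrable_const_bound[of _ 1])
  show "AE p in M \<Otimes>\<^sub>M M. norm (case p of (s, t) \<Rightarrow> cone_weight a (circ s) (circ t)) \<le> 1"
    by (intro AE_I2) (auto simp: cone_weight_nonneg cone_weight_le)
qed measurable

text \<open>Integrate \<open>cone_weight_diff\<close> over independent pairs: swapping the two
  points preserves the integral, so the left side gives
  \<open>2 * (cone_mass a - cone_mass b)\<close>, and the right side gives \<open>0\<close> by
  \<open>integral_weight_cdet\<close>.\<close>

lemma cone_mass_eq_if_pos:
  assumes "cdet a b > 0"
  shows "cone_mass a = cone_mass b"
proof -
  let ?c = "\<lambda>a (s, t). cone_weight a (circ s) (circ t)"
  let ?c' = "\<lambda>a (s, t). cone_weight a (circ t) (circ s)"
  let ?k = "\<lambda>x. both_pos (- cdet a x) (cdet b x)"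
  let ?k1 = "\<lambda>(s, t). ?k (circ t) * cdet (circ s) (circ t)"
  let ?k2 = "\<lambda>(s, t). ?k (circ s) * cdet (circ t) (circ s)"
  have swap: "integrable (M \<Otimes>\<^sub>M M) (?c' a)" "(\<integral>p. ?c' a p \<partial>(M \<Otimes>\<^sub>M M)) = cone_mass a" for a
    using PP.integrable_product_swap[OF integrable_cone_weight[of a]]
      PP.integral_product_swap[OF borel_measurable_integrable[OF integrable_cone_weight[of a]]]
    by (simp_all add: cone_mass_def case_prod_beta')
  have K: "integrable (M \<Otimes>\<^sub>M M) ?k1" "(\<integral>p. ?k1 p \<partial>(M \<Otimes>\<^sub>M M)) = 0"
    by (intro integral_weight_cdet; simp add: both_pos_bounds)+
  have K': "integrable (M \<Otimes>\<^sub>M M) ?k2" "(\<integral>p. ?k2 p \<partial>(M \<Otimes>\<^sub>M M)) = 0"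
    using PP.integrable_product_swap[OF K(1)]
      PP.integral_product_swap[OF borel_measurable_integrable[OF K(1)]] K(2)
    by (simp_all add: case_prod_beta')
  have "?c a p = ?c b p + ?c' b p - ?c' a p + ?k1 p + ?k2 p" for p
    using cone_weight_diff[OF assms, of "circ (fst p)" "circ (snd p)"] cdet_swap[of "circ (fst p)" "circ (snd p)"]
    by (simp add: case_prod_beta' algebra_simps)
  then have "cone_mass a = (\<integral>p. ?c b p + ?c' b p - ?c' a p + ?k1 p + ?k2 p \<partial>(M \<Otimes>\<^sub>M M))"
    unfolding cone_mass_def by (intro Bochner_Integration.integral_cong) auto
  also have "\<dots> = cone_mass b + cone_mass b - cone_mass a"
    using integrable_cone_weight[of b] swap K K' by (simp add: cone_mass_def[symmetric])
  finally show ?thesis by simp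
qed

lemma cone_mass_eq:
  assumes "norm a = 1" "norm b = 1"
  shows "cone_mass a = cone_mass b"
proof -
  consider "cdet a b > 0" | "cdet b a > 0" | "cdet a b = 0"
    by (metis cdet_swap linorder_neqE neg_0_less_iff_less)
  then show ?thesis
  proof cases
    case 3
    \<comment> \<open>Antipodal directions are compared through \<open>\<i> * a\<close>, a quarter
      turn from each.\<close>
    have "cone_mass a = cone_mass (- a)"
    proof -
      have p: "cdet a (\<i> * a) > 0"
        using assms(1) by (auto simp: cdet_def complex_eq_iff norm_complex_def power2_eq_square intro!: sum_squares_gt_zero_iff[THEN iffD2])
      then have "cdet (\<i> * a) (- a) > 0" by (simp add: cdet_swap[of "\<i> * a"])
      then show ?thesis using p cone_mass_eq_if_pos by metis
    qed
    then show ?thesis using cdet_eq_0_unit[OF assms 3] by auto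
  qed (auto dest: cone_mass_eq_if_pos)
qed

text \<open>Fubini: a product of three equal factors is invariant under cyclic permutation of the
  coordinates.\<close>

lemma integral_rotate:
  fixes F :: "real \<Rightarrow> real \<Rightarrow> real \<Rightarrow> complex"
  assumes [measurable]: "(\<lambda>(s, t, u). F s t u) \<in> borel_measurable (M \<Otimes>\<^sub>M (M \<Otimes>\<^sub>M M))"
    and b: "\<And>s t u. norm (F s t u) \<le> B"
  shows "(\<integral>(s, t, u). F t u s \<partial>(M \<Otimes>\<^sub>M (M \<Otimes>\<^sub>M M))) = (\<integral>(s, t, u). F s t u \<partial>(M \<Otimes>\<^sub>M (M \<Otimes>\<^sub>M M)))"
proof -
  have m [measurable]: "(\<lambda>(s, t, u). F t u s) \<in> borel_measurable (M \<Otimes>\<^sub>M (M \<Otimes>\<^sub>M M))"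
  proof -
    have "(\<lambda>p. (fst (snd p), snd (snd p), fst p)) \<in> M \<Otimes>\<^sub>M (M \<Otimes>\<^sub>M M) \<rightarrow>\<^sub>M M \<Otimes>\<^sub>M (M \<Otimes>\<^sub>M M)"
      by measurable
    from measurable_compose[OF this assms(1)] show ?thesis by (simp add: case_prod_beta')
  qed
  have i1: "integrable (M \<Otimes>\<^sub>M (M \<Otimes>\<^sub>M M)) (\<lambda>(s, t, u). F s t u)"
    by (rule PPP.integrable_const_bound[of _ B]) (use b in auto)
  have i2: "integrable (M \<Otimes>\<^sub>M (M \<Otimes>\<^sub>M M)) (\<lambda>(s, t, u). F t u s)"
    by (rule PPP.integrable_const_bound[of _ B]) (use b m in auto)
  have "(\<integral>(s, t, u). F t u s \<partial>(M \<Otimes>\<^sub>M (M \<Otimes>\<^sub>M M))) = (\<integral>q. (\<integral>s. F (fst q) (snd q) s \<partial>M) \<partial>(M \<Otimes>\<^sub>M M))"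
    using PPP.integral_snd[of "\<lambda>s q. F (fst q) (snd q) s"] i2 by (simp add: case_prod_beta')
  also have "\<dots> = (\<integral>s. (\<integral>t. (\<integral>u. F s t u \<partial>M) \<partial>M) \<partial>M)"
  proof -
    have "integrable (M \<Otimes>\<^sub>M M) (\<lambda>q. \<integral>s. F (fst q) (snd q) s \<partial>M)"
      using PPP.integrable_snd[of "\<lambda>s q. F (fst q) (snd q) s"] i2 by (simp add: case_prod_beta')
    then show ?thesis
      using PP.integral_fst'[of "\<lambda>q. \<integral>s. F (fst q) (snd q) s \<partial>M"] by simp
  qed
  also have "\<dots> = (\<integral>s. (\<integral>q. F s (fst q) (snd q) \<partial>(M \<Otimes>\<^sub>M M)) \<partial>M)"
  proof (rule Bochner_Integration.integral_cong[OF refl])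
    fix s
    have "integrable (M \<Otimes>\<^sub>M M) (\<lambda>q. F s (fst q) (snd q))"
    proof (rule PP.integrable_const_bound[of _ B])
      have "(\<lambda>q. (s, q)) \<in> M \<Otimes>\<^sub>M M \<rightarrow>\<^sub>M M \<Otimes>\<^sub>M (M \<Otimes>\<^sub>M M)"
        by measurable
      from measurable_compose[OF this assms(1)]
      show "(\<lambda>q. F s (fst q) (snd q)) \<in> borel_measurable (M \<Otimes>\<^sub>M M)" by (simp add: case_prod_beta')
    qed (use b in auto)
    then show "(\<integral>t. (\<integral>u. F s t u \<partial>M) \<partial>M) = (\<integral>q. F s (fst q) (snd q) \<partial>(M \<Otimes>\<^sub>M M))"
      using PP.integral_fst'[of "\<lambda>q. F s (fst q) (snd q)"] by simp
  qed
  also have "\<dots> = (\<integral>(s, t, u). F s t u \<partial>(M \<Otimes>\<^sub>M (M \<Otimes>\<^sub>M M)))"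
    using PPP.integral_fst'[OF i1] by (simp add: case_prod_beta')
  finally show ?thesis .
qed

end

section \<open>Rational directions that detect positively oriented pairs\<close>

lemma circ_surj:
  assumes "norm e = 1"
  obtains t where "circ t = e"
proof
  show "circ (Arg e / (2 * pi)) = e"
    using assms cis_Arg[of e] by (cases "e = 0") (auto simp: circ_def sgn_eq)
qed

text \<open>Positivity of both determinants is an open condition on the angle, so one admissible
  direction yields a rational angle. With countably many directions, exceptional null sets can be
  united.\<close>

lemma rational_cone_weight_pos:
  assumes "cdet x y > 0"
  shows "\<exists>r\<in>\<rat>. cone_weight (circ r) x y > 0"
proof -
  have "x + y \<noteq> 0"
    using assms by (metis add_eq_0_iff cdet_minus(2) cdet_self less_irrefl minus_zero)
  \<comment> \<open>The direction opposite to the bisector of \<open>x\<close> and \<open>y\<close>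
    makes both determinants equal and positive.\<close>
  define e where "e = - sgn (x + y)"
  have "norm e = 1" using \<open>x + y \<noteq> 0\<close> by (simp add: e_def norm_sgn)
  then obtain t where t: "circ t = e" by (rule circ_surj)
  have "cdet e x = cdet x y / norm (x + y)" "cdet y e = cdet x y / norm (x + y)"
    by (simp_all add: e_def cdet_def sgn_eq algebra_simps add_divide_distrib diff_divide_distrib)
  then have "cdet (circ t) x > 0" "cdet y (circ t) > 0"
    using assms \<open>x + y \<noteq> 0\<close> by (simp_all add: t)
  moreover have "open ({t. cdet (circ t) x > 0} \<inter> {t. cdet y (circ t) > 0})" (is "open ?U")
    by (intro open_Int open_Collect_less continuous_intros)
  ultimately obtain d where d: "d > 0" "ball t d \<subseteq> ?U"
    using openE[of ?U t] by blast
  obtain r where r: "r \<in> \<rat>" "t < r" "r < t + d"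
    using Rats_dense_in_real[of t "t + d"] d(1) by auto
  then have "r \<in> ?U" using d by (auto simp: dist_real_def subset_iff)
  then show ?thesis
    using r(1) assms by (auto simp: cone_weight_def both_pos_def)
qed

section \<open>The mixture over random triangles\<close>

context centered_distribution
begin

abbreviation "M3 \<equiv> M \<Otimes>\<^sub>M (M \<Otimes>\<^sub>M M)"

text \<open>Integrating out the other two vertices leaves \<open>cone_mass (circ s)\<close>, which
  is constant by \<open>cone_mass_eq\<close>.\<close>

lemma integral_cone_weight:
  fixes g :: "real \<Rightarrow> complex"
  assumes [measurable]: "g \<in> borel_measurable borel" and b: "\<And>t. norm (g t) \<le> B"
  shows "(\<integral>(s, t, u). cone_weight (circ s) (circ t) (circ u) *\<^sub>R g s \<partial>M3) = cone_mass 1 *\<^sub>R (\<integral>t. g t \<partial>M)"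
proof -
  have "integrable M3 (\<lambda>(s, q). cone_weight (circ s) (circ (fst q)) (circ (snd q)) *\<^sub>R g s)"
  proof (rule PPP.integrable_const_bound[of _ B])
    show "AE p in M3. norm (case p of (s, q) \<Rightarrow> cone_weight (circ s) (circ (fst q)) (circ (snd q)) *\<^sub>R g s) \<le> B"
      using b cone_weight_nonneg cone_weight_le
      by (intro AE_I2) (auto simp: split_beta intro!: order.trans[OF mult_left_le_one_le])
  qed measurable
  from PPP.integral_fst[OF this]
  have "(\<integral>(s, t, u). cone_weight (circ s) (circ t) (circ u) *\<^sub>R g s \<partial>M3)
      = (\<integral>s. (\<integral>q. cone_weight (circ s) (circ (fst q)) (circ (snd q)) *\<^sub>R g s \<partial>(M \<Otimes>\<^sub>M M)) \<partial>M)"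
    by (simp add: case_prod_beta')
  also have "\<dots> = (\<integral>s. cone_mass 1 *\<^sub>R g s \<partial>M)"
  proof (rule Bochner_Integration.integral_cong[OF refl])
    fix s
    have "(\<integral>q. cone_weight (circ s) (circ (fst q)) (circ (snd q)) *\<^sub>R g s \<partial>(M \<Otimes>\<^sub>M M)) = cone_mass (circ s) *\<^sub>R g s"
      using integrable_cone_weight[of "circ s"] by (simp add: cone_mass_def case_prod_beta')
    then show "(\<integral>q. cone_weight (circ s) (circ (fst q)) (circ (snd q)) *\<^sub>R g s \<partial>(M \<Otimes>\<^sub>M M)) = cone_mass 1 *\<^sub>R g s"
      using cone_mass_eq[of "circ s" 1] by simp
  qed
  finally show ?thesis by simp
qed

text \<open>Pairing of \<open>g\<close> with the weighted but unnormalised measure attached to a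
  triple; \<open>g = 1\<close> gives its total mass.\<close>

definition weighted_sum :: "(real \<Rightarrow> 'b::real_vector) \<Rightarrow> real \<times> real \<times> real \<Rightarrow> 'b" where
  "weighted_sum g = (\<lambda>(s, t, u). triangle_weight (circ s) (circ t) (circ u) *\<^sub>R
     (cdet (circ t) (circ u) *\<^sub>R g s + cdet (circ u) (circ s) *\<^sub>R g t + cdet (circ s) (circ t) *\<^sub>R g u))"

lemma weighted_sum_cone_weight:
  "weighted_sum g (s, t, u) = cone_weight (circ s) (circ t) (circ u) *\<^sub>R g s
     + cone_weight (circ t) (circ u) (circ s) *\<^sub>R g t + cone_weight (circ u) (circ s) (circ t) *\<^sub>R g u"
  using triangle_weight_cdet[of "circ s" "circ t" "circ u"]
    triangle_weight_cdet[of "circ t" "circ u" "circ s"] triangle_weight_cdet[of "circ u" "circ s" "circ t"]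
    triangle_weight_rotate[of "circ t" "circ u" "circ s"] triangle_weight_rotate[of "circ u" "circ s" "circ t"]
  by (simp add: weighted_sum_def scaleR_add_right)

text \<open>The three vertex terms are cyclic rotations of one another and have the same integral,
  whence the factor \<open>3\<close>.\<close>

lemma integral_weighted_sum:
  fixes g :: "real \<Rightarrow> complex"
  assumes [measurable]: "g \<in> borel_measurable borel" and b: "\<And>t. norm (g t) \<le> B"
  shows "integrable M3 (weighted_sum g)"
    and "(\<integral>p. weighted_sum g p \<partial>M3) = (3 * cone_mass 1) *\<^sub>R (\<integral>t. g t \<partial>M)"
proof -
  define F where "F s t u = cone_weight (circ s) (circ t) (circ u) *\<^sub>R g s" for s t u
  have Fb: "norm (F s t u) \<le> B" for s t u
    using b cone_weight_nonneg cone_weight_le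
    by (auto simp: F_def intro!: order.trans[OF mult_left_le_one_le])
  have Fm: "(\<lambda>(s, t, u). F s t u) \<in> borel_measurable M3" "(\<lambda>(s, t, u). F t u s) \<in> borel_measurable M3"
     "(\<lambda>(s, t, u). F u s t) \<in> borel_measurable M3"
    unfolding F_def by measurable
  have Fi: "integrable M3 (\<lambda>(s, t, u). F s t u)" "integrable M3 (\<lambda>(s, t, u). F t u s)"
     "integrable M3 (\<lambda>(s, t, u). F u s t)"
    using Fm by (auto intro!: PPP.integrable_const_bound[of _ B] AE_I2 simp: Fb)
  have eq: "weighted_sum g = (\<lambda>p. (case p of (s, t, u) \<Rightarrow> F s t u) + (case p of (s, t, u) \<Rightarrow> F t u s)
      + (case p of (s, t, u) \<Rightarrow> F u s t))"
    by (auto simp: fun_eq_iff weighted_sum_cone_weight F_def)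
  show "integrable M3 (weighted_sum g)"
    unfolding eq using Fi by (intro Bochner_Integration.integrable_add)
  have "(\<integral>p. weighted_sum g p \<partial>M3) = (\<integral>(s, t, u). F s t u \<partial>M3) + (\<integral>(s, t, u). F t u s \<partial>M3) + (\<integral>(s, t, u). F u s t \<partial>M3)"
    unfolding eq using Fi by (simp add: Bochner_Integration.integral_add)
  moreover have "(\<integral>(s, t, u). F t u s \<partial>M3) = (\<integral>(s, t, u). F s t u \<partial>M3)"
    by (rule integral_rotate[OF Fm(1) Fb])
  moreover have "(\<integral>(s, t, u). F u s t \<partial>M3) = (\<integral>(s, t, u). F t u s \<partial>M3)"
    by (rule integral_rotate[of "\<lambda>s t u. F t u s", OF Fm(2) Fb])
  moreover have "(\<integral>(s, t, u). F s t u \<partial>M3) = cone_mass 1 *\<^sub>R (\<integral>t. g t \<partial>M)"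
    unfolding F_def by (rule integral_cone_weight[OF assms])
  ultimately show "(\<integral>p. weighted_sum g p \<partial>M3) = (3 * cone_mass 1) *\<^sub>R (\<integral>t. g t \<partial>M)"
    by (simp add: scaleR_conv_of_real)
qed

text \<open>The total mass undoes the normalisation in \<open>bary\<close>; for triples not around
  \<open>0\<close> all cone weights vanish and both sides are \<open>0\<close>.\<close>

lemma weighted_sum_bary_circ:
  fixes G :: "complex \<Rightarrow> 'b::real_vector"
  shows "weighted_sum (\<lambda>_. 1) p *\<^sub>R pair_w (bary_circ p) G = weighted_sum (\<lambda>t. G (circ t)) p"
proof -
  obtain s t u where p: "p = (s, t, u)" by (cases p) auto
  show ?thesis
  proof (cases "around_zero (circ s) (circ t) (circ u)")
    case True
    then show ?thesis
      by (simp add: p weighted_sum_def bary_circ_def pair_w_bary around_zero_def)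
  next
    case False
    then have "cone_weight (circ s) (circ t) (circ u) = 0 \<and> cone_weight (circ t) (circ u) (circ s) = 0
       \<and> cone_weight (circ u) (circ s) (circ t) = 0"
      by (auto simp: around_zero_def cone_weight_def both_pos_def max_def)
    then show ?thesis by (simp add: p weighted_sum_cone_weight)
  qed
qed

lemma weighted_sum_one_nonneg: "weighted_sum (\<lambda>_. 1::real) p \<ge> 0"
  by (cases p) (simp add: weighted_sum_cone_weight cone_weight_nonneg)

text \<open>Vanishing cone masses in all rational directions force \<open>cdet \<le> 0\<close> for
  almost every pair. Its integral is \<open>0\<close>, so almost every pair is collinear with
  \<open>0\<close>, and centredness balances the two remaining points.\<close>

lemma two_point_if_cone_mass_0:
  assumes "cone_mass 1 = 0"
  obtains a where "norm a = 1"
    "\<And>g :: complex \<Rightarrow> complex. (\<lambda>t. g (circ t)) \<in> borel_measurable borel \<Longrightarrow>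
       (\<integral>t. g (circ t) \<partial>M) = (1/2) *\<^sub>R (g a + g (- a))"
proof -
  have "AE p in M \<Otimes>\<^sub>M M. \<forall>r\<in>\<rat>. cone_weight (circ r) (circ (fst p)) (circ (snd p)) = 0"
  proof (subst AE_ball_countable[OF countable_rat], intro ballI)
    fix r :: real
    have "cone_mass (circ r) = 0" using assms cone_mass_eq[of "circ r" 1] by simp
    then show "AE p in M \<Otimes>\<^sub>M M. cone_weight (circ r) (circ (fst p)) (circ (snd p)) = 0"
      using integral_nonneg_eq_0_iff_AE[OF integrable_cone_weight[of "circ r"]] cone_weight_nonneg
      by (simp add: cone_mass_def case_prod_beta')
  qed
  \<comment> \<open>The factor \<open>1\<close> puts the integrand in the form of
    \<open>integral_weight_cdet\<close> with constant weight.\<close>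
  then have "AE p in M \<Otimes>\<^sub>M M. 0 \<le> - (1 * cdet (circ (fst p)) (circ (snd p)))"
  proof eventually_elim
    case (elim p)
    then show ?case using rational_cone_weight_pos[of "circ (fst p)" "circ (snd p)"] by force
  qed
  moreover have "integrable (M \<Otimes>\<^sub>M M) (\<lambda>p. - (1 * cdet (circ (fst p)) (circ (snd p))))"
    "(\<integral>p. - (1 * cdet (circ (fst p)) (circ (snd p))) \<partial>(M \<Otimes>\<^sub>M M)) = 0"
    using integral_weight_cdet[of "\<lambda>_. 1"] by (simp_all add: case_prod_beta')
  ultimately have "AE p in M \<Otimes>\<^sub>M M. - (1 * cdet (circ (fst p)) (circ (snd p))) = 0"
    using integral_nonneg_eq_0_iff_AE by blast
  from PP.AE_pair[OF this] have "AE s in M. AE t in M. cdet (circ s) (circ t) = 0"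
    by simp
  \<comment> \<open>One good \<open>s\<close> is enough: almost all of \<open>M\<close> then lies on
    the line through \<open>circ s\<close>.\<close>
  from eventually_happens'[OF ae_filter_bot this]
  obtain s where s: "AE t in M. cdet (circ s) (circ t) = 0" ..
  define a where "a = circ s"
  have a: "norm a = 1" "a \<noteq> - a" by (auto simp: a_def)
  define A where "A = {t. circ t = a}"
  have A: "A \<in> sets M" unfolding A_def by simp
  have "AE t in M. circ t = a \<or> circ t = - a"
    using s by eventually_elim (use cdet_eq_0_unit in \<open>auto simp: a_def\<close>)
  then have AE: "AE t in M. g (circ t) = indicator A t *\<^sub>R (g a - g (- a)) + g (- a)" for g :: "complex \<Rightarrow> complex"
    by eventually_elim (use a(2) in \<open>auto simp: A_def\<close>)
  have int: "(\<integral>t. g (circ t) \<partial>M) = measure M A *\<^sub>R (g a - g (- a)) + g (- a)"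
    if "(\<lambda>t. g (circ t)) \<in> borel_measurable borel" for g :: "complex \<Rightarrow> complex"
  proof -
    have "(\<integral>t. g (circ t) \<partial>M) = (\<integral>t. indicator A t *\<^sub>R (g a - g (- a)) + g (- a) \<partial>M)"
      by (rule integral_cong_AE) (use A that AE in auto)
    also have "\<dots> = measure M A *\<^sub>R (g a - g (- a)) + g (- a)"
      using A by (subst Bochner_Integration.integral_add) (auto simp: prob_space[simplified] emeasure_eq_measure)
    finally show ?thesis .
  qed
  \<comment> \<open>The identity as test function computes the barycentre and so determines the mass
    at \<open>a\<close>.\<close>
  have "measure M A *\<^sub>R (a - (- a)) + (- a) = 0"
    using int[of "\<lambda>x. x"] centered by simp
  then have "of_real (2 * measure M A - 1) * a = 0"
    by (simp add: scaleR_conv_of_real algebra_simps)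
  then have half: "measure M A = 1/2"
    using a(1) by (auto simp del: of_real_diff of_real_mult)
  have "(\<integral>t. g (circ t) \<partial>M) = (1/2) *\<^sub>R (g a + g (- a))"
    if "(\<lambda>t. g (circ t)) \<in> borel_measurable borel" for g :: "complex \<Rightarrow> complex"
    using int[OF that] unfolding half by (simp add: scaleR_conv_of_real field_simps)
  with a(1) show ?thesis by (rule that)
qed

theorem ThetaHat_decomposition:
  obtains \<nu> where "sets \<nu> = sets theta_borel" "emeasure \<nu> ThetaHat = 1"
    "\<And>g :: complex \<Rightarrow> complex. continuous_on unit_circle g \<Longrightarrow>
      integrable \<nu> (\<lambda>\<theta>. pair_w \<theta> g) \<and> (\<integral>\<theta>. pair_w \<theta> g \<partial>\<nu>) = (\<integral>t. g (circ t) \<partial>M)"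
proof (cases "cone_mass 1 = 0")
  case True
  then obtain a where a: "norm a = 1" and int: "\<And>g :: complex \<Rightarrow> complex.
      (\<lambda>t. g (circ t)) \<in> borel_measurable borel \<Longrightarrow> (\<integral>t. g (circ t) \<partial>M) = (1/2) *\<^sub>R (g a + g (- a))"
    by (rule two_point_if_cone_mass_0) blast
  have T: "two_point a \<in> ThetaHat" using a by (auto simp: ThetaHat_def unit_circle_def)
  interpret R: prob_space "return theta_borel (two_point a)"
    using T by (intro prob_space_return) simp
  show ?thesis
  proof (rule that[of "return theta_borel (two_point a)"])
    show "emeasure (return theta_borel (two_point a)) ThetaHat = 1"
      using R.emeasure_space_1 by simp
    fix g :: "complex \<Rightarrow> complex" assume g: "continuous_on unit_circle g"
    note m = measurable_pair_w[OF g]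
    have "continuous_on UNIV (\<lambda>t. g (circ t))"
      by (rule continuous_on_compose2[OF g continuous_on_circ]) (auto simp: unit_circle_def)
    then have "(\<integral>t. g (circ t) \<partial>M) = (1/2) *\<^sub>R (g a + g (- a))"
      by (intro int borel_measurable_continuous_onI)
    then have "(\<integral>\<theta>. pair_w \<theta> g \<partial>return theta_borel (two_point a)) = (\<integral>t. g (circ t) \<partial>M)"
      using m T a by (subst integral_return) (auto simp: pair_w_two_point)
    moreover have "integrable (return theta_borel (two_point a)) (\<lambda>\<theta>. pair_w \<theta> g)"
      unfolding integrable_iff_bounded using m T by (simp add: nn_integral_return)
    ultimately show "integrable (return theta_borel (two_point a)) (\<lambda>\<theta>. pair_w \<theta> g) \<and>
        (\<integral>\<theta>. pair_w \<theta> g \<partial>return theta_borel (two_point a)) = (\<integral>t. g (circ t) \<partial>M)"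
      by blast
  qed simp
next
  case False
  define c where "c = cone_mass 1"
  have c: "c > 0"
  proof -
    have "c \<ge> 0"
      unfolding c_def cone_mass_def
      by (rule Bochner_Integration.integral_nonneg) (simp add: split_beta cone_weight_nonneg)
    then show ?thesis using False by (simp add: c_def)
  qed
  \<comment> \<open>Here \<open>3 * c\<close> is the integral of the total mass, so \<open>q\<close>
    is a probability density on triples; its image under \<open>bary_circ\<close> will be
    \<open>\<nu>\<close>.\<close>
  define q where "q p = weighted_sum (\<lambda>_. 1::real) p / (3 * c)" for p
  have q0: "q p \<ge> 0" for p using c weighted_sum_one_nonneg by (simp add: q_def)
  have qm [measurable]: "q \<in> borel_measurable M3"
    unfolding q_def weighted_sum_def by measurable
  have "sets M3 = sets (borel \<Otimes>\<^sub>M (borel \<Otimes>\<^sub>M borel))"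
    by (intro sets_pair_measure_cong) auto
  then have setsM3: "sets M3 = sets borel"
    by (simp only: borel_prod)
  have bm': "bary_circ \<in> M3 \<rightarrow>\<^sub>M theta_borel"
    using measurable_bary_circ unfolding measurable_cong_sets[OF setsM3 refl] .
  then have bm: "bary_circ \<in> density M3 q \<rightarrow>\<^sub>M theta_borel"
    by simp
  have main: "integrable (density M3 q) (\<lambda>p. pair_w (bary_circ p) g)"
      "(\<integral>p. pair_w (bary_circ p) g \<partial>density M3 q) = (\<integral>t. g (circ t) \<partial>M)"
    if g: "continuous_on unit_circle g" for g :: "complex \<Rightarrow> complex"
  proof -
    have "compact (g ` unit_circle)"
      using g by (intro compact_continuous_image) (simp_all add: unit_circle_def)
    then obtain B where "\<forall>w\<in>g ` unit_circle. norm w \<le> B"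
      using compact_imp_bounded[of "g ` unit_circle"] unfolding bounded_iff by blast
    then have B: "norm (g (circ t)) \<le> B" for t
      by (simp add: unit_circle_def)
    have "continuous_on UNIV (\<lambda>t. g (circ t))"
      by (rule continuous_on_compose2[OF g continuous_on_circ]) (auto simp: unit_circle_def)
    then have [measurable]: "(\<lambda>t. g (circ t)) \<in> borel_measurable borel"
      by (rule borel_measurable_continuous_onI)
    have pm: "(\<lambda>p. pair_w (bary_circ p) g) \<in> borel_measurable M3"
      by (rule measurable_compose[OF bm' measurable_pair_w[OF g]])
    have eq: "q p *\<^sub>R pair_w (bary_circ p) g = (1 / (3 * c)) *\<^sub>R weighted_sum (\<lambda>t. g (circ t)) p" for p
      by (simp add: q_def flip: weighted_sum_bary_circ)
    show "integrable (density M3 q) (\<lambda>p. pair_w (bary_circ p) g)"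
      using pm q0 integral_weighted_sum(1)[OF _ B] by (subst integrable_density) (auto simp: eq)
    show "(\<integral>p. pair_w (bary_circ p) g \<partial>density M3 q) = (\<integral>t. g (circ t) \<partial>M)"
      using pm q0 integral_weighted_sum(2)[OF _ B] c by (subst integral_density) (auto simp: eq c_def)
  qed
  have "emeasure (density M3 q) (space M3) = 1"
  proof -
    \<comment> \<open>\<open>integral_weighted_sum\<close> is stated for complex values, so the real
      total mass is computed through its complex copy.\<close>
    have wc: "weighted_sum (\<lambda>_. 1::complex) p = of_real (weighted_sum (\<lambda>_. 1::real) p)" for p
      by (cases p) (simp add: weighted_sum_cone_weight scaleR_conv_of_real)
    have "integrable M3 (\<lambda>p. weighted_sum (\<lambda>_. 1::complex) p)"
      "(\<integral>p. weighted_sum (\<lambda>_. 1::complex) p \<partial>M3) = of_real (3 * c)"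
      using integral_weighted_sum[of "\<lambda>_. 1" 1] by (simp_all add: prob_space[simplified] c_def scaleR_conv_of_real)
    then have "integrable M3 (\<lambda>p. weighted_sum (\<lambda>_. 1::real) p)"
      "(\<integral>p. weighted_sum (\<lambda>_. 1::real) p \<partial>M3) = 3 * c"
      unfolding wc complex_of_real_integrable_eq integral_complex_of_real of_real_eq_iff by auto
    then have "integrable M3 q" "(\<integral>p. q p \<partial>M3) = 1"
      unfolding q_def using c by auto
    then have "(\<integral>\<^sup>+p. ennreal (q p) \<partial>M3) = 1"
      using q0 by (subst nn_integral_eq_integral) (auto simp del: split_paired_All)
    moreover have "emeasure (density M3 q) (space M3) = (\<integral>\<^sup>+p. ennreal (q p) * indicator (space M3) p \<partial>M3)"
      by (rule emeasure_density[OF _ sets.top]) measurable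
    moreover have "\<dots> = (\<integral>\<^sup>+p. ennreal (q p) \<partial>M3)"
      by (rule nn_integral_cong) simp
    ultimately show ?thesis by simp
  qed
  then have e: "emeasure (distr (density M3 q) theta_borel bary_circ) ThetaHat = 1"
    using bm by (subst emeasure_distr) (auto simp: bary_circ_in_ThetaHat space_pair_measure vimage_def sets.top[of theta_borel, simplified])
  show ?thesis
  proof (rule that[of "distr (density M3 q) theta_borel bary_circ"])
    show "emeasure (distr (density M3 q) theta_borel bary_circ) ThetaHat = 1" by (rule e)
    fix g :: "complex \<Rightarrow> complex" assume g: "continuous_on unit_circle g"
    show "integrable (distr (density M3 q) theta_borel bary_circ) (\<lambda>\<theta>. pair_w \<theta> g) \<and>
        (\<integral>\<theta>. pair_w \<theta> g \<partial>distr (density M3 q) theta_borel bary_circ) = (\<integral>t. g (circ t) \<partial>M)"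
      using main[OF g] bm measurable_pair_w[OF g] by (simp add: integrable_distr_eq integral_distr)
  qed simp
qed

end

section \<open>Application of the decomposition to the Herglotz kernel\<close>

theorem mainTheorem6:
  fixes f :: "complex \<Rightarrow> complex"
  assumes "f analytic_on ball 0 1"
    and "\<And>z. z \<in> ball 0 1 \<Longrightarrow> Re (f z) > 0"
    and "deriv f 0 = 0"
    and "f 0 \<in> \<real>" and "Re (f 0) > 0"
  shows "\<exists>\<nu> :: circ_meas measure.
           space \<nu> = ThetaHat \<and> sets \<nu> = borel_sets_of weakstar_top \<and>
           emeasure \<nu> ThetaHat = ennreal (Re (f 0)) \<and>
           (\<forall>z \<in> ball 0 1. integrable \<nu> (\<lambda>\<theta>. h_theta \<theta> z) \<and>
              f z = (\<integral>\<theta>. h_theta \<theta> z \<partial>\<nu>))"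
proof -
  define m where "m = Re (f 0)"
  have m: "m > 0" "f 0 = of_real m" using assms(4,5) by (auto simp: m_def elim: Reals_cases)
  have hol: "f holomorphic_on ball 0 1"
    using assms(1) by (rule analytic_imp_holomorphic)
  obtain M where M: "real_distribution M"
    and rep: "\<And>z. norm z < 1 \<Longrightarrow> f z = of_real m * (\<integral>t. (circ t + z) / (circ t - z) \<partial>M)"
    using Herglotz_representation[OF hol m(2,1)] assms(2) by auto
  have "(f has_field_derivative 0) (at 0)"
    using holomorphic_derivI[OF hol, of 0] assms(3) by simp
  then have "(\<integral>t. circ t \<partial>M) = 0"
    using Herglotz_first_moment[OF M rep] m(1) by simp
  then interpret centered_distribution M
    using M by (simp add: centered_distribution_def centered_distribution_axioms_def)
  obtain \<nu> where \<nu>: "sets \<nu> = sets theta_borel" "emeasure \<nu> ThetaHat = 1"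
    and int: "\<And>g :: complex \<Rightarrow> complex. continuous_on unit_circle g \<Longrightarrow>
      integrable \<nu> (\<lambda>\<theta>. pair_w \<theta> g) \<and> (\<integral>\<theta>. pair_w \<theta> g \<partial>\<nu>) = (\<integral>t. g (circ t) \<partial>M)"
    by (rule ThetaHat_decomposition) blast
  have sp: "space \<nu> = ThetaHat" using sets_eq_imp_space_eq[OF \<nu>(1)] by simp
  \<comment> \<open>Scaling the probability measure by \<open>m\<close> gives the total mass
    \<open>f 0\<close> and absorbs the factor in front of the Herglotz integral.\<close>
  let ?\<nu> = "density \<nu> (\<lambda>_. ennreal m)"
  have "integrable ?\<nu> (\<lambda>\<theta>. h_theta \<theta> z) \<and> f z = (\<integral>\<theta>. h_theta \<theta> z \<partial>?\<nu>)" if z: "z \<in> ball 0 1" for z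
  proof -
    have "continuous_on unit_circle (\<lambda>w. (w + z) / (w - z))"
      using z by (intro continuous_intros) (auto simp: unit_circle_def)
    note I = int[OF this]
    then have "(\<lambda>\<theta>. h_theta \<theta> z) \<in> borel_measurable \<nu>"
      by (auto simp: h_theta_def)
    with I m(1) z show ?thesis
      by (simp add: h_theta_def integrable_density integral_density rep scaleR_conv_of_real)
  qed
  moreover have "emeasure ?\<nu> ThetaHat = ennreal (Re (f 0))"
    using \<nu>(2) sp sets.top[of \<nu>] by (simp add: emeasure_density_const m_def)
  ultimately show ?thesis
    using sp \<nu>(1) sets_theta_borel by (intro exI[of _ ?\<nu>]) auto
qed

end
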